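(* Let $0<p<1$ and let $ZC1_n$ be the first Zagreb connection index of the random polyomino chain $RPC(n,p)$. Then, as $n\to\infty$, $$\frac{ZC1_n-(50-18p+2p^2-2p^3)n}{\sqrt n}\xrightarrow{D} N(0,\sigma^2),\qquad \sigma^2=4p(1-p)(5p^4-7p^3+56p^2-35p+81).$$
   Context: A polyomino chain with $n$ squares is a sequence of unit squares $S_1,\dots,S_n$ in the plane in which consecutive squares share exactly one edge and the centers of consecutive squares form a path; it is regarded as the graph whose vertices are the corners of the squares and whose edges are the sides of the squares. For $3\le k\le n$, the link $L_k\in\{1,2\}$ is $1$ if $S_k$ is attached to $S_{k-1}$ so that $S_{k-2},S_{k-1},S_k$ lie on a straight line, and $2$ if $S_k$ is attached to a side of $S_{k-1}$ adjacent to the side shared with $S_{k-2}$ (a turn). The random polyomino chain $RPC(n,p)$ is obtained by starting from one square, attaching a second square, and for $k=3,\dots,n$ attaching $S_k$ with link $L_k$, where $L_3,\dots,L_n$ are independent with $\mathbb P(L_k=1)=p$, $\mathbb P(L_k=2)=1-p$. For a vertex $v$, $\tau_v$ is the number of vertices at distance exactly $2$ from $v$; $ZC1_n=\sum_{v}\tau_v^2$ computed in $RPC(n,p)$. $N(\mu,\sigma^2)$ is the normal distribution and $\xrightarrow{D}$ denotes convergence in distribution.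
   Formalization: The links alone do not fix the side of a turn, and ZC1 depends on it (turn–straight–turn in U or Z shape gives different values); the formal chain takes every turn opposite to the previous one (monotone staircase), for which the stated constants hold. *)

theory Defs
  imports "HOL-Probability.Probability"
begin

text \<open>Polyomino chain determined by the link sequence L (L k = True means link 1,
  i.e. straight; L k = False means link 2, a turn), k = 3..n.
  Square k (k \<ge> 1) is the unit square with lower-left corner sq_pos L k.
  Convention: S_1 at the origin, S_2 to its right; every turn alternates between the
  directions right and up (so the chain is a monotone staircase and never touches itself).\<close>

fun dir_right :: "(nat \<Rightarrow> bool) \<Rightarrow> nat \<Rightarrow> bool" where
  "dir_right L 0 = True"
| "dir_right L (Suc k) =
     (if Suc k \<ge> 3 then (if L (Suc k) then dir_right L k else \<not> dir_right L k) else True)"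

fun sq_pos :: "(nat \<Rightarrow> bool) \<Rightarrow> nat \<Rightarrow> int \<times> int" where
  "sq_pos L 0 = (0, 0)"
| "sq_pos L (Suc 0) = (0, 0)"
| "sq_pos L (Suc (Suc k)) =
     (let (a, b) = sq_pos L (Suc k) in
      if dir_right L (Suc (Suc k)) then (a + 1, b) else (a, b + 1))"

definition sq_sides :: "int \<times> int \<Rightarrow> (int \<times> int) set set" where
  "sq_sides c = (case c of (a, b) \<Rightarrow>
     {{(a, b), (a + 1, b)}, {(a, b), (a, b + 1)},
      {(a + 1, b), (a + 1, b + 1)}, {(a, b + 1), (a + 1, b + 1)}})"

definition sq_corners :: "int \<times> int \<Rightarrow> (int \<times> int) set" where
  "sq_corners c = (case c of (a, b) \<Rightarrow> {(a, b), (a + 1, b), (a, b + 1), (a + 1, b + 1)})"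

definition pc_vertices :: "nat \<Rightarrow> (nat \<Rightarrow> bool) \<Rightarrow> (int \<times> int) set" where
  "pc_vertices n L = (\<Union>k\<in>{1..n}. sq_corners (sq_pos L k))"

definition pc_adj :: "nat \<Rightarrow> (nat \<Rightarrow> bool) \<Rightarrow> int \<times> int \<Rightarrow> int \<times> int \<Rightarrow> bool" where
  "pc_adj n L u v \<longleftrightarrow> (\<exists>k\<in>{1..n}. {u, v} \<in> sq_sides (sq_pos L k))"

fun has_walk :: "('v \<Rightarrow> 'v \<Rightarrow> bool) \<Rightarrow> nat \<Rightarrow> 'v \<Rightarrow> 'v \<Rightarrow> bool" where
  "has_walk E 0 v w = (v = w)"
| "has_walk E (Suc k) v w = (\<exists>u. E v u \<and> has_walk E k u w)"

definition at_dist :: "('v \<Rightarrow> 'v \<Rightarrow> bool) \<Rightarrow> nat \<Rightarrow> 'v \<Rightarrow> 'v \<Rightarrow> bool" where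
  "at_dist E k v w \<longleftrightarrow> has_walk E k v w \<and> (\<forall>j<k. \<not> has_walk E j v w)"

definition tau :: "nat \<Rightarrow> (nat \<Rightarrow> bool) \<Rightarrow> int \<times> int \<Rightarrow> nat" where
  "tau n L v = card {w \<in> pc_vertices n L. at_dist (pc_adj n L) 2 v w}"

definition ZC1 :: "nat \<Rightarrow> (nat \<Rightarrow> bool) \<Rightarrow> nat" where
  "ZC1 n L = (\<Sum>v\<in>pc_vertices n L. (tau n L v)\<^sup>2)"

end

theory Submission
  imports Defs
begin

text \<open>
  The chain is a monotone staircase, so it is layered by \<open>x + y\<close>: each level \<open>l\<close> with
  \<open>1 \<le> l \<le> n\<close> consists of two opposite corners of square \<open>l\<close>, and consecutive levels are joined by
  three edges whose pattern is governed by the direction of the step from square \<open>l\<close> to square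
  \<open>l + 1\<close>. Apart from six levels at the ends, whose contribution is bounded, level \<open>l\<close> therefore
  contributes to the index a function of the three links \<open>L\<^sub>l\<close>, \<open>L\<^sub>l\<^sub>+\<^sub>1\<close>, \<open>L\<^sub>l\<^sub>+\<^sub>2\<close> only.

  Up to a bounded error, a centred sum of functions of three consecutive i.i.d. variables is a sum
  \<open>S\<^sub>n\<close> of bounded martingale differences \<open>D\<^sub>k\<close>. The characteristic function of \<open>S\<^sub>k\<close> at \<open>s\<close> is
  multiplied by \<open>1 - s\<^sup>2 v / 2\<close> up to \<open>O(s\<^sup>3)\<close> when \<open>k\<close> increases by one: the linear term vanishes
  by the martingale property, and the quadratic term decouples because \<open>D\<^sub>k\<close> is independent of
  \<open>S\<^sub>k\<^sub>-\<^sub>2\<close>, from which \<open>S\<^sub>k\<close> differs by a bounded amount. With \<open>s = t / sqrt n\<close> the \<open>n\<close> errors add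
  up to \<open>O(1 / sqrt n)\<close>, and Levy's continuity theorem applies.
\<close>

section \<open>Characteristic functions\<close>

lemma norm_iexp_diff_le: "cmod (iexp x - iexp y) \<le> \<bar>x - y\<bar>"
proof -
  have "iexp x - iexp y = iexp y * (iexp (x - y) - 1)"
    by (simp add: right_diff_distrib exp_add[symmetric])
  then have "cmod (iexp x - iexp y) = cmod (iexp (x - y) - 1)"
    by (simp add: norm_mult)
  also have "\<dots> \<le> \<bar>x - y\<bar>"
    using iexp_approx1[of "x - y" 0] by simp
  finally show ?thesis .
qed

lemma norm_iexp_diff_taylor2_le: "cmod (iexp x - (1 + \<i> * x - x\<^sup>2 / 2)) \<le> \<bar>x\<bar> ^ 3 / 6"
proof -
  have "(\<Sum>k\<le>2. (\<i> * of_real x) ^ k / fact k) = 1 + \<i> * x - x\<^sup>2 / 2"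
    by (simp add: numeral_2_eq_2 power_mult_distrib)
  with iexp_approx1[of x 2] show ?thesis
    by (simp add: numeral_3_eq_3 fact_numeral numeral_2_eq_2)
qed

lemma norm_diff_power_le_of_linear_recurrence:
  fixes a :: "nat \<Rightarrow> 'a :: real_normed_algebra_1"
  assumes "norm c \<le> 1" and "\<And>k. norm (a (Suc k) - c * a k) \<le> \<epsilon>"
  shows "norm (a n - c ^ n * a 0) \<le> real n * \<epsilon>"
proof (induction n)
  case (Suc n)
  have "a (Suc n) - c ^ Suc n * a 0 = (a (Suc n) - c * a n) + c * (a n - c ^ n * a 0)"
    by (simp add: algebra_simps)
  also have "norm \<dots> \<le> \<epsilon> + norm c * norm (a n - c ^ n * a 0)"
    using assms(2) by (intro norm_triangle_mono norm_mult_ineq)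
  also have "\<dots> \<le> \<epsilon> + 1 * (real n * \<epsilon>)"
    using Suc.IH assms(1) by (intro add_left_mono mult_mono) auto
  finally show ?case by (simp add: algebra_simps)
qed simp

lemma char_normal:
  assumes "\<sigma> > 0"
  shows "char (density lborel (normal_density \<mu> \<sigma>)) t =
    iexp (t * \<mu>) * complex_of_real (exp (- (\<sigma>\<^sup>2 * t\<^sup>2) / 2))"
proof -
  interpret N: prob_space std_normal_distribution by (rule prob_space_normal_density) simp
  have "distributed std_normal_distribution lborel (\<lambda>x. x) std_normal_density"
    by (simp add: distributed_def distr_id2)
  from N.normal_density_affine[OF this, of \<sigma> \<mu>] assms
  have "distributed std_normal_distribution lborel (\<lambda>x. \<mu> + \<sigma> * x) (normal_density \<mu> \<sigma>)" by simp
  then have "density lborel (normal_density \<mu> \<sigma>) =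
      distr std_normal_distribution lborel (\<lambda>x. \<mu> + \<sigma> * x)"
    by (simp add: distributed_def)
  then have "char (density lborel (normal_density \<mu> \<sigma>)) t =
      (CLINT x|std_normal_distribution. iexp (t * (\<mu> + \<sigma> * x)))"
    by (simp add: char_def integral_distr)
  also have "\<dots> = iexp (t * \<mu>) * char std_normal_distribution (t * \<sigma>)"
    by (simp add: char_def distrib_left exp_add mult.assoc)
  finally show ?thesis
    by (simp add: char_std_normal_distribution power_mult_distrib mult.commute)
qed

lemma real_distribution_normal:
  "\<sigma> > 0 \<Longrightarrow> real_distribution (density lborel (normal_density \<mu> \<sigma>))"
  by (simp add: real_distribution_def real_distribution_axioms_def prob_space_normal_density)

lemma (in prob_space) norm_integral_le_const:
  fixes f :: "'a \<Rightarrow> 'b :: {banach, second_countable_topology}"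
  assumes "\<And>\<omega>. \<omega> \<in> space M \<Longrightarrow> norm (f \<omega>) \<le> B"
  shows "norm (\<integral>\<omega>. f \<omega> \<partial>M) \<le> B"
proof (cases "integrable M f")
  case True
  then have "norm (\<integral>\<omega>. f \<omega> \<partial>M) \<le> (\<integral>\<omega>. B \<partial>M)"
    using assms by (intro order_trans[OF integral_norm_bound] integral_mono) auto
  then show ?thesis by (simp add: prob_space)
next
  case False
  obtain \<omega> where "\<omega> \<in> space M"
    using not_empty by blast
  then have "0 \<le> B"
    using assms norm_ge_zero order_trans by blast
  then show ?thesis by (simp add: not_integrable_integral_eq[OF False])
qed

lemma (in prob_space) norm_char_distr_diff_le:
  assumes [measurable]: "random_variable borel U" "random_variable borel V"
    and "\<And>\<omega>. \<omega> \<in> space M \<Longrightarrow> \<bar>U \<omega> - V \<omega>\<bar> \<le> \<epsilon>"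
  shows "cmod (char (distr M borel U) t - char (distr M borel V) t) \<le> \<bar>t\<bar> * \<epsilon>"
proof -
  have "char (distr M borel U) t - char (distr M borel V) t =
      (CLINT \<omega>|M. iexp (t * U \<omega>) - iexp (t * V \<omega>))"
    by (simp add: char_def integral_distr integrable_iexp)
  also have "cmod \<dots> \<le> \<bar>t\<bar> * \<epsilon>"
  proof (rule norm_integral_le_const)
    fix \<omega> assume "\<omega> \<in> space M"
    have "cmod (iexp (t * U \<omega>) - iexp (t * V \<omega>)) \<le> \<bar>t * U \<omega> - t * V \<omega>\<bar>"
      by (rule norm_iexp_diff_le)
    also have "\<dots> \<le> \<bar>t\<bar> * \<epsilon>"
      using assms(3)[OF \<open>\<omega> \<in> space M\<close>]
      by (simp add: right_diff_distrib[symmetric] abs_mult mult_left_mono)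
    finally show "cmod (iexp (t * U \<omega>) - iexp (t * V \<omega>)) \<le> \<bar>t\<bar> * \<epsilon>" .
  qed
  finally show ?thesis .
qed

lemma (in prob_space) weak_conv_m_distr_uniformly_close:
  assumes "\<And>n. random_variable borel (U n)" and "\<And>n. random_variable borel (V n)"
    and "real_distribution N" and "weak_conv_m (\<lambda>n. distr M borel (V n)) N"
    and "\<And>n \<omega>. \<omega> \<in> space M \<Longrightarrow> \<bar>U n \<omega> - V n \<omega>\<bar> \<le> \<epsilon> n" and "\<epsilon> \<longlonglongrightarrow> 0"
  shows "weak_conv_m (\<lambda>n. distr M borel (U n)) N"
proof (rule levy_continuity)
  fix t
  have "(\<lambda>n. char (distr M borel (V n)) t) \<longlonglongrightarrow> char N t"
    using assms by (intro levy_continuity1 real_distribution_distr)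
  moreover have "(\<lambda>n. char (distr M borel (U n)) t - char (distr M borel (V n)) t) \<longlonglongrightarrow> 0"
  proof (rule Lim_null_comparison)
    show "(\<lambda>n. \<bar>t\<bar> * \<epsilon> n) \<longlonglongrightarrow> 0"
      using assms(6) by (rule tendsto_mult_right_zero)
  qed (use assms norm_char_distr_diff_le in auto)
  ultimately show "(\<lambda>n. char (distr M borel (U n)) t) \<longlonglongrightarrow> char N t"
    by (rule Lim_transform)
qed (use assms in auto)

lemma tendsto_const_divide_sqrt: "(\<lambda>n. C / sqrt (real n)) \<longlonglongrightarrow> 0"
  by (intro tendsto_divide_0[OF tendsto_const] filterlim_at_top_imp_at_infinity
      filterlim_compose[OF sqrt_at_top filterlim_real_sequentially])

section \<open>A central limit theorem for bounded martingale differences\<close>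

text \<open>
  The two expectations are all that the characteristic functions see of the martingale property and
  of a constant conditional variance \<open>v\<close> of \<open>D\<^sub>k\<close> given the first \<open>k - m\<close> differences. For
  \<open>k < m\<close> the truncated difference \<open>k - m\<close> makes the inner sum empty.
\<close>

locale bounded_martingale_differences = prob_space M for M :: "'a measure" +
  fixes D :: "nat \<Rightarrow> 'a \<Rightarrow> real" and B v :: real and m :: nat
  assumes measurable_D [measurable]: "\<And>k. D k \<in> borel_measurable M"
    and abs_D_le: "\<And>k \<omega>. \<bar>D k \<omega>\<bar> \<le> B"
    and expectation_D: "\<And>s k. (CLINT \<omega>|M. iexp (s * (\<Sum>j<k. D j \<omega>)) * D k \<omega>) = 0"
    and expectation_D_square:
      "\<And>s k. (CLINT \<omega>|M. iexp (s * (\<Sum>j<k - m. D j \<omega>)) * ((D k \<omega>)\<^sup>2 - v)) = 0"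
begin

definition partial_sum :: "nat \<Rightarrow> 'a \<Rightarrow> real" where
  "partial_sum k \<omega> = (\<Sum>j<k. D j \<omega>)"

lemma measurable_partial_sum [measurable]: "partial_sum k \<in> borel_measurable M"
  unfolding partial_sum_def by measurable

lemma D_square_le: "(D k \<omega>)\<^sup>2 \<le> B\<^sup>2"
  using abs_D_le[of k \<omega>] by (simp add: abs_le_square_iff[symmetric])

lemma B_nonneg: "0 \<le> B"
  using abs_D_le order_trans abs_ge_zero by blast

lemma v_eq_expectation_D_square: "v = expectation (\<lambda>\<omega>. (D 0 \<omega>)\<^sup>2)"
proof -
  have "integrable M (\<lambda>\<omega>. (D 0 \<omega>)\<^sup>2)"
    using D_square_le by (intro integrable_const_bound[of _ "B\<^sup>2"]) auto
  then have "complex_of_real (expectation (\<lambda>\<omega>. (D 0 \<omega>)\<^sup>2) - v) = (CLINT \<omega>|M. (D 0 \<omega>)\<^sup>2 - v)"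
    by (simp add: prob_space flip: integral_complex_of_real of_real_power of_real_diff)
  then show ?thesis
    using expectation_D_square[of 0 0] by simp
qed

lemma v_bounds: "0 \<le> v" "v \<le> B\<^sup>2"
proof -
  show "0 \<le> v" by (simp add: v_eq_expectation_D_square)
  have "norm (expectation (\<lambda>\<omega>. (D 0 \<omega>)\<^sup>2)) \<le> B\<^sup>2"
    using D_square_le by (intro norm_integral_le_const) auto
  then show "v \<le> B\<^sup>2" by (simp add: v_eq_expectation_D_square)
qed

lemma abs_partial_sum_diff_le: "\<bar>partial_sum k \<omega> - partial_sum (k - m) \<omega>\<bar> \<le> m * B"
proof -
  have "partial_sum k \<omega> - partial_sum (k - m) \<omega> = (\<Sum>j\<in>{k - m..<k}. D j \<omega>)"
    unfolding partial_sum_def lessThan_atLeast0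
    by (rule sum_diff_nat_ivl) auto
  also have "\<bar>\<dots>\<bar> \<le> (\<Sum>j\<in>{k - m..<k}. B)"
    by (intro order_trans[OF sum_abs] sum_mono abs_D_le)
  also have "\<dots> \<le> m * B"
    using B_nonneg by (simp add: mult_right_mono)
  finally show ?thesis .
qed

abbreviation sum_char :: "nat \<Rightarrow> real \<Rightarrow> complex" where
  "sum_char k \<equiv> char (distr M borel (partial_sum k))"

lemma sum_char_eq: "sum_char k s = (CLINT \<omega>|M. iexp (s * partial_sum k \<omega>))"
  by (simp add: char_def integral_distr)

definition taylor_error :: "real \<Rightarrow> nat \<Rightarrow> 'a \<Rightarrow> complex" where
  "taylor_error s k \<omega> = iexp (s * partial_sum k \<omega>) *
     (iexp (s * D k \<omega>) - (1 + \<i> * (s * D k \<omega>) - (s * D k \<omega>)\<^sup>2 / 2))"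

definition lag_error :: "real \<Rightarrow> nat \<Rightarrow> 'a \<Rightarrow> complex" where
  "lag_error s k \<omega> = s\<^sup>2 / 2 *
     ((iexp (s * partial_sum k \<omega>) - iexp (s * partial_sum (k - m) \<omega>)) * ((D k \<omega>)\<^sup>2 - v))"

lemma measurable_taylor_error [measurable]: "taylor_error s k \<in> borel_measurable M"
  unfolding taylor_error_def[abs_def] by measurable

lemma measurable_lag_error [measurable]: "lag_error s k \<in> borel_measurable M"
  unfolding lag_error_def[abs_def] by measurable

lemma norm_taylor_error_le: "cmod (taylor_error s k \<omega>) \<le> \<bar>s\<bar> ^ 3 * B ^ 3 / 6"
proof -
  have "cmod (taylor_error s k \<omega>) \<le> \<bar>s * D k \<omega>\<bar> ^ 3 / 6"
    using norm_iexp_diff_taylor2_le[of "s * D k \<omega>"] by (simp add: taylor_error_def norm_mult)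
  also have "\<dots> \<le> \<bar>s\<bar> ^ 3 * B ^ 3 / 6"
    using abs_D_le by (auto simp: abs_mult power_mult_distrib intro!: mult_left_mono power_mono)
  finally show ?thesis .
qed

lemma norm_lag_error_le: "cmod (lag_error s k \<omega>) \<le> m * (\<bar>s\<bar> ^ 3 * B ^ 3) / 2"
proof -
  have "cmod (iexp (s * partial_sum k \<omega>) - iexp (s * partial_sum (k - m) \<omega>)) \<le>
      \<bar>s * partial_sum k \<omega> - s * partial_sum (k - m) \<omega>\<bar>"
    by (rule norm_iexp_diff_le)
  also have "\<dots> \<le> \<bar>s\<bar> * (m * B)"
    using abs_partial_sum_diff_le
    by (simp add: right_diff_distrib[symmetric] abs_mult mult_left_mono)
  finally have "cmod (iexp (s * partial_sum k \<omega>) - iexp (s * partial_sum (k - m) \<omega>))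
      \<le> \<bar>s\<bar> * (m * B)" .
  moreover have "\<bar>(D k \<omega>)\<^sup>2 - v\<bar> \<le> B\<^sup>2"
    using D_square_le[of k \<omega>] v_bounds zero_le_power2[of "D k \<omega>"] by linarith
  ultimately have "cmod (lag_error s k \<omega>) \<le> s\<^sup>2 / 2 * ((\<bar>s\<bar> * (m * B)) * B\<^sup>2)"
    unfolding lag_error_def norm_mult
    by (intro mult_mono)
      (auto simp: norm_divide norm_power B_nonneg simp flip: of_real_power of_real_diff)
  also have "\<dots> = m * (\<bar>s\<bar> ^ 3 * B ^ 3) / 2"
  proof -
    have "\<bar>s\<bar> ^ 3 = s\<^sup>2 * \<bar>s\<bar>" "B ^ 3 = B * B\<^sup>2"
      by (simp_all add: power3_eq_cube power2_eq_square)
    then show ?thesis by simp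
  qed
  finally show ?thesis .
qed

lemma iexp_partial_sum_Suc:
  "iexp (s * partial_sum (Suc k) \<omega>) = (1 - s\<^sup>2 * v / 2) * iexp (s * partial_sum k \<omega>)
     + taylor_error s k \<omega> - lag_error s k \<omega>
     + \<i> * s * (iexp (s * partial_sum k \<omega>) * D k \<omega>)
     - s\<^sup>2 / 2 * (iexp (s * partial_sum (k - m) \<omega>) * ((D k \<omega>)\<^sup>2 - v))"
proof -
  have "iexp (s * partial_sum (Suc k) \<omega>) = iexp (s * partial_sum k \<omega>) * iexp (s * D k \<omega>)"
    by (simp add: partial_sum_def distrib_left exp_add)
  then show ?thesis
    by (simp add: taylor_error_def lag_error_def field_simps power2_eq_square)
qed

lemma sum_char_Suc:
  "sum_char (Suc k) s = (1 - s\<^sup>2 * v / 2) * sum_char k s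
     + (CLINT \<omega>|M. taylor_error s k \<omega> - lag_error s k \<omega>)"
proof -
  have integrable_errors: "integrable M (taylor_error s k)" "integrable M (lag_error s k)"
    by (rule integrable_const_bound[OF AE_I2[OF norm_taylor_error_le]], measurable)
      (rule integrable_const_bound[OF AE_I2[OF norm_lag_error_le]], measurable)
  have integrable_first_order: "integrable M (\<lambda>\<omega>. iexp (s * partial_sum k \<omega>) * D k \<omega>)"
    using abs_D_le by (intro integrable_const_bound[of _ B]) (auto simp: norm_mult)
  have integrable_second_order:
    "integrable M (\<lambda>\<omega>. iexp (s * partial_sum (k - m) \<omega>) * ((D k \<omega>)\<^sup>2 - v))"
  proof (intro integrable_const_bound[of _ "B\<^sup>2 + v"])
    have "norm ((D k \<omega>)\<^sup>2 - v) \<le> B\<^sup>2 + v" for \<omega>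
      using D_square_le[of k \<omega>] v_bounds zero_le_power2[of "D k \<omega>"]
      unfolding real_norm_def by linarith
    then show "AE \<omega> in M. cmod (iexp (s * partial_sum (k - m) \<omega>) * ((D k \<omega>)\<^sup>2 - v)) \<le> B\<^sup>2 + v"
      by (auto simp: norm_mult simp flip: of_real_power of_real_diff)
  qed measurable
  show ?thesis
    unfolding sum_char_eq iexp_partial_sum_Suc
    using expectation_D[of s k] expectation_D_square[of s k]
      integrable_errors integrable_first_order integrable_second_order
    by (simp add: integrable_iexp flip: partial_sum_def)
qed

lemma norm_sum_char_step_le:
  "cmod (sum_char (Suc k) s - (1 - s\<^sup>2 * v / 2) * sum_char k s)
     \<le> real (m + 1) * (\<bar>s\<bar> ^ 3 * B ^ 3)"
proof -
  have "cmod (taylor_error s k \<omega> - lag_error s k \<omega>) \<le> real (m + 1) * (\<bar>s\<bar> ^ 3 * B ^ 3)" for \<omega>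
  proof -
    define c where "c = \<bar>s\<bar> ^ 3 * B ^ 3"
    have "0 \<le> c" using B_nonneg by (simp add: c_def)
    have "cmod (taylor_error s k \<omega> - lag_error s k \<omega>) \<le> c / 6 + m * c / 2"
      using norm_taylor_error_le norm_lag_error_le unfolding c_def
      by (intro order_trans[OF norm_triangle_ineq4] add_mono)
    also have "\<dots> \<le> c + m * c"
      using \<open>0 \<le> c\<close> by (intro add_mono) auto
    finally show ?thesis by (simp add: c_def algebra_simps)
  qed
  then show ?thesis
    unfolding sum_char_Suc by (auto intro!: norm_integral_le_const)
qed

lemma norm_sum_char_diff_power_le:
  assumes "s\<^sup>2 * v \<le> 2"
  shows "cmod (sum_char n s - complex_of_real ((1 - s\<^sup>2 * v / 2) ^ n))
     \<le> real n * (real (m + 1) * (\<bar>s\<bar> ^ 3 * B ^ 3))"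
proof -
  have "cmod (1 - s\<^sup>2 * v / 2) \<le> 1"
  proof -
    have "\<bar>1 - s\<^sup>2 * v / 2\<bar> \<le> 1" using assms v_bounds by auto
    then show ?thesis by (simp flip: norm_of_real[where 'a = complex])
  qed
  from norm_diff_power_le_of_linear_recurrence[where a = "\<lambda>n. sum_char n s", OF this
      norm_sum_char_step_le]
  show ?thesis by (simp add: sum_char_eq partial_sum_def prob_space)
qed

lemma sum_char_tendsto:
  "(\<lambda>n. sum_char n (t / sqrt n)) \<longlonglongrightarrow> complex_of_real (exp (- (v * t\<^sup>2) / 2))"
proof -
  let ?x = "- (v * t\<^sup>2) / 2"
  let ?C = "real (m + 1) * (\<bar>t\<bar> ^ 3 * B ^ 3)"
  have "(\<lambda>n. complex_of_real ((1 + ?x / real n) ^ n)) \<longlonglongrightarrow> complex_of_real (exp ?x)"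
    by (intro tendsto_of_real tendsto_exp_limit_sequentially)
  moreover have "(\<lambda>n. sum_char n (t / sqrt n) - complex_of_real ((1 + ?x / real n) ^ n)) \<longlonglongrightarrow> 0"
  proof (rule Lim_null_comparison[OF _ tendsto_const_divide_sqrt])
    have "\<forall>\<^sub>F n in sequentially. real n \<ge> v * t\<^sup>2"
      using filterlim_real_sequentially by (simp add: filterlim_at_top)
    then show "\<forall>\<^sub>F n in sequentially.
        cmod (sum_char n (t / sqrt n) - complex_of_real ((1 + ?x / real n) ^ n))
          \<le> ?C / sqrt n"
      using eventually_gt_at_top[of 0]
    proof eventually_elim
      case (elim n)
      have "(t / sqrt n)\<^sup>2 * v \<le> 2"
        using elim by (simp add: power_divide field_simps)
      moreover have "1 - (t / sqrt n)\<^sup>2 * v / 2 = 1 + ?x / real n"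
        by (simp add: power_divide mult.commute)
      moreover have "real n * (real (m + 1) * (\<bar>t / sqrt n\<bar> ^ 3 * B ^ 3)) = ?C / sqrt n"
        using elim by (simp add: power_divide power3_eq_cube)
      ultimately show ?case
        using norm_sum_char_diff_power_le[of "t / sqrt n" n] by metis
    qed
  qed
  ultimately show ?thesis by (rule Lim_transform)
qed

theorem central_limit_theorem_martingale_differences:
  assumes "0 < v"
  shows "weak_conv_m (\<lambda>n. distr M borel (\<lambda>\<omega>. partial_sum n \<omega> / sqrt n))
    (density lborel (normal_density 0 (sqrt v)))"
proof (rule levy_continuity)
  fix t
  have "char (distr M borel (\<lambda>\<omega>. partial_sum n \<omega> / sqrt n)) t = sum_char n (t / sqrt n)" for n
    by (simp add: char_def integral_distr)
  then show "(\<lambda>n. char (distr M borel (\<lambda>\<omega>. partial_sum n \<omega> / sqrt n)) t)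
      \<longlonglongrightarrow> char (density lborel (normal_density 0 (sqrt v))) t"
    using sum_char_tendsto[of t] assms by (simp add: char_normal)
qed (use assms in \<open>auto intro: real_distribution_normal\<close>)

end

section \<open>Window sums of i.i.d. sequences\<close>

definition window :: "nat \<Rightarrow> (nat \<Rightarrow> 'b) \<Rightarrow> 'b \<times> 'b \<times> 'b" where
  "window k x = (x k, x (k + 1), x (k + 2))"

definition window_mean_given2 :: "'b measure \<Rightarrow> ('b \<times> 'b \<times> 'b \<Rightarrow> real) \<Rightarrow> 'b \<Rightarrow> 'b \<Rightarrow> real" where
  "window_mean_given2 Q f a b = (LINT c|Q. f (a, b, c))"

definition window_mean_given1 :: "'b measure \<Rightarrow> ('b \<times> 'b \<times> 'b \<Rightarrow> real) \<Rightarrow> 'b \<Rightarrow> real" where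
  "window_mean_given1 Q f a = (LINT b|Q. window_mean_given2 Q f a b)"

definition window_mean :: "'b measure \<Rightarrow> ('b \<times> 'b \<times> 'b \<Rightarrow> real) \<Rightarrow> real" where
  "window_mean Q f = (LINT a|Q. window_mean_given1 Q f a)"

text \<open>The effect of revealing \<open>c\<close> on the conditional means of the three windows that contain it.\<close>

definition martingale_part :: "'b measure \<Rightarrow> ('b \<times> 'b \<times> 'b \<Rightarrow> real) \<Rightarrow> 'b \<times> 'b \<times> 'b \<Rightarrow> real" where
  "martingale_part Q f = (\<lambda>(a, b, c). (f (a, b, c) - window_mean_given2 Q f a b)
     + (window_mean_given2 Q f b c - window_mean_given1 Q f b)
     + (window_mean_given1 Q f c - window_mean Q f))"

definition window_variance :: "'b measure \<Rightarrow> ('b \<times> 'b \<times> 'b \<Rightarrow> real) \<Rightarrow> real" where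
  "window_variance Q f = window_mean Q (\<lambda>x. (martingale_part Q f x)\<^sup>2)"

lemma sum_window_decomposition:
  "(\<Sum>k<n. f (window k x)) - window_mean Q f * real n = (\<Sum>k<n. martingale_part Q f (window k x))
     + (window_mean_given2 Q f (x 0) (x 1) + window_mean_given1 Q f (x 1))
     - (window_mean_given2 Q f (x n) (x (n + 1)) + window_mean_given1 Q f (x (n + 1)))"
  by (induction n) (simp_all add: window_def martingale_part_def algebra_simps)

locale bounded_window_function = prob_space Q for Q :: "'b measure" +
  fixes f :: "'b \<times> 'b \<times> 'b \<Rightarrow> real" and C :: real
  assumes measurable_f [measurable]: "f \<in> borel_measurable (Q \<Otimes>\<^sub>M Q \<Otimes>\<^sub>M Q)"
    and abs_f_le: "\<And>x. \<bar>f x\<bar> \<le> C"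
begin

lemma measurable_window_mean_given2 [measurable]:
  "(\<lambda>(a, b). window_mean_given2 Q f a b) \<in> borel_measurable (Q \<Otimes>\<^sub>M Q)"
  unfolding window_mean_given2_def by measurable

lemma measurable_window_mean_given1 [measurable]: "window_mean_given1 Q f \<in> borel_measurable Q"
  unfolding window_mean_given1_def[abs_def] by measurable

lemma abs_window_mean_given2_le: "\<bar>window_mean_given2 Q f a b\<bar> \<le> C"
  using norm_integral_le_const[of "\<lambda>c. f (a, b, c)" C] abs_f_le
  by (simp add: window_mean_given2_def)

lemma abs_window_mean_given1_le: "\<bar>window_mean_given1 Q f a\<bar> \<le> C"
  using norm_integral_le_const[of "window_mean_given2 Q f a" C] abs_window_mean_given2_le
  by (simp add: window_mean_given1_def)

lemma abs_window_mean_le: "\<bar>window_mean Q f\<bar> \<le> C"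
  using norm_integral_le_const[of "window_mean_given1 Q f" C] abs_window_mean_given1_le
  by (simp add: window_mean_def)

lemma measurable_martingale_part [measurable]:
  "martingale_part Q f \<in> borel_measurable (Q \<Otimes>\<^sub>M Q \<Otimes>\<^sub>M Q)"
  unfolding martingale_part_def by measurable

lemma abs_martingale_part_le: "\<bar>martingale_part Q f x\<bar> \<le> 6 * C"
proof (cases x)
  case (fields a b c)
  then show ?thesis
    using abs_f_le[of "(a, b, c)"]
      abs_window_mean_given2_le[of a b] abs_window_mean_given2_le[of b c]
      abs_window_mean_given1_le[of b] abs_window_mean_given1_le[of c] abs_window_mean_le
    by (simp add: martingale_part_def abs_le_iff)
qed

lemma window_mean_given2_martingale_part:
  assumes "a \<in> space Q" "b \<in> space Q"
  shows "window_mean_given2 Q (martingale_part Q f) a b = 0"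
proof -
  note assms [measurable (raw)]
  have "integrable Q (\<lambda>c. f (a, b, c))" "integrable Q (window_mean_given2 Q f b)"
      "integrable Q (window_mean_given1 Q f)"
    using abs_f_le abs_window_mean_given2_le abs_window_mean_given1_le assms
    by (auto intro!: integrable_const_bound[of _ C])
  then show ?thesis
    by (simp add: martingale_part_def prob_space window_mean_def
        window_mean_given2_def[of Q _ a b] window_mean_given1_def[of Q f b])
qed

lemma window_mean_diff_const: "window_mean Q (\<lambda>x. f x - d) = window_mean Q f - d"
proof -
  have "window_mean_given2 Q (\<lambda>x. f x - d) a b = window_mean_given2 Q f a b - d"
    if [measurable (raw)]: "a \<in> space Q" "b \<in> space Q" for a b
  proof -
    have "integrable Q (\<lambda>c. f (a, b, c))"
      using abs_f_le by (auto intro!: integrable_const_bound[of _ C])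
    then show ?thesis by (simp add: window_mean_given2_def prob_space)
  qed
  moreover have "integrable Q (window_mean_given2 Q f a)" if [measurable (raw)]: "a \<in> space Q" for a
    using abs_window_mean_given2_le by (auto intro!: integrable_const_bound[of _ C])
  ultimately have "window_mean_given1 Q (\<lambda>x. f x - d) a = window_mean_given1 Q f a - d"
    if "a \<in> space Q" for a
    using that
    by (simp add: window_mean_given1_def prob_space cong: Bochner_Integration.integral_cong)
  moreover have "integrable Q (window_mean_given1 Q f)"
    using abs_window_mean_given1_le by (auto intro!: integrable_const_bound[of _ C])
  ultimately show ?thesis
    by (simp add: window_mean_def prob_space cong: Bochner_Integration.integral_cong)
qed

lemma abs_sum_window_diff_le:
  "\<bar>(\<Sum>k<n. f (window k x)) - window_mean Q f * real n
     - (\<Sum>k<n. martingale_part Q f (window k x))\<bar> \<le> 4 * C"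
  using sum_window_decomposition[of f x n Q]
    abs_window_mean_given2_le[of "x 0" "x 1"] abs_window_mean_given1_le[of "x 1"]
    abs_window_mean_given2_le[of "x n" "x (n + 1)"] abs_window_mean_given1_le[of "x (n + 1)"]
  by linarith

lemma bounded_window_function_martingale_part:
  "bounded_window_function Q (martingale_part Q f) (6 * C)"
  by unfold_locales (auto simp: abs_martingale_part_le)

lemma bounded_window_function_square: "bounded_window_function Q (\<lambda>x. (f x)\<^sup>2) (C\<^sup>2)"
proof unfold_locales
  show "\<bar>(f x)\<^sup>2\<bar> \<le> C\<^sup>2" for x
    using power_mono[OF abs_f_le[of x], of 2] by simp
qed measurable

lemma bounded_window_function_diff_const: "bounded_window_function Q (\<lambda>x. f x - d) (C + \<bar>d\<bar>)"
proof unfold_locales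
  show "\<bar>f x - d\<bar> \<le> C + \<bar>d\<bar>" for x
    using abs_f_le[of x] by linarith
qed measurable

end

lemma (in prob_space) expectation_indep_var_iterated:
  fixes h :: "'b \<times> 'b \<Rightarrow> 'c :: {banach, second_countable_topology}"
  assumes indep: "indep_var S U T V" and [measurable]: "h \<in> borel_measurable (S \<Otimes>\<^sub>M T)"
    and "integrable M (\<lambda>\<omega>. h (U \<omega>, V \<omega>))"
  shows "(\<integral>\<omega>. h (U \<omega>, V \<omega>) \<partial>M) = (\<integral>\<omega>. (\<integral>y. h (U \<omega>, y) \<partial>distr M T V) \<partial>M)"
proof -
  note [measurable] = indep_var_rv1[OF indep] indep_var_rv2[OF indep]
  interpret U: prob_space "distr M S U" by (rule prob_space_distr) measurable
  interpret V: prob_space "distr M T V" by (rule prob_space_distr) measurable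
  interpret pair: pair_prob_space "distr M S U" "distr M T V" ..
  have joint: "distr M S U \<Otimes>\<^sub>M distr M T V = distr M (S \<Otimes>\<^sub>M T) (\<lambda>\<omega>. (U \<omega>, V \<omega>))"
    using indep unfolding indep_var_distribution_eq by blast
  have "integrable (distr M S U \<Otimes>\<^sub>M distr M T V) h"
    using assms(3) unfolding joint by (subst integrable_distr_eq) auto
  from pair.integral_fst'[OF this]
  have "(\<integral>\<omega>. h (U \<omega>, V \<omega>) \<partial>M) = (\<integral>x. (\<integral>y. h (x, y) \<partial>distr M T V) \<partial>distr M S U)"
    unfolding joint by (simp add: integral_distr)
  also have "\<dots> = (\<integral>\<omega>. (\<integral>y. h (U \<omega>, y) \<partial>distr M T V) \<partial>M)"
    by (subst integral_distr) auto
  finally show ?thesis .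
qed

locale iid_sequence = prob_space M for M :: "'a measure" +
  fixes Q :: "'b measure" and Y :: "nat \<Rightarrow> 'a \<Rightarrow> 'b"
  assumes indep_Y: "indep_vars (\<lambda>_. Q) Y UNIV"
    and distr_Y: "\<And>k. distr M Q (Y k) = Q"
begin

lemma measurable_Y [measurable]: "Y k \<in> measurable M Q"
  using indep_Y by (auto simp: indep_vars_def)

sublocale Q: prob_space Q
  using prob_space_distr[OF measurable_Y, of 0] by (simp add: distr_Y)

abbreviation trajectory :: "'a \<Rightarrow> nat \<Rightarrow> 'b" where
  "trajectory \<omega> \<equiv> \<lambda>i. Y i \<omega>"

definition past :: "nat \<Rightarrow> 'a \<Rightarrow> nat \<Rightarrow> 'b" where
  "past n \<omega> = restrict (trajectory \<omega>) {..<n}"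

lemma past_apply [simp]: "i < n \<Longrightarrow> past n \<omega> i = Y i \<omega>"
  by (simp add: past_def)

lemma measurable_past [measurable]: "past n \<in> measurable M (PiM {..<n} (\<lambda>_. Q))"
  unfolding past_def[abs_def] by measurable

lemma expectation_integrate_out_next:
  fixes h :: "(nat \<Rightarrow> 'b) \<times> 'b \<Rightarrow> 'c :: {banach, second_countable_topology}"
  assumes [measurable]: "h \<in> borel_measurable (PiM {..<n} (\<lambda>_. Q) \<Otimes>\<^sub>M Q)"
    and "\<And>x. norm (h x) \<le> C"
  shows "(\<integral>\<omega>. h (past n \<omega>, Y n \<omega>) \<partial>M) = (\<integral>\<omega>. (\<integral>y. h (past n \<omega>, y) \<partial>Q) \<partial>M)"
proof -
  let ?next = "\<lambda>\<omega>. \<lambda>i\<in>{n}. Y i \<omega>"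
  have "indep_var (PiM {..<n} (\<lambda>_. Q)) (past n) (PiM {n} (\<lambda>_. Q)) ?next"
    unfolding past_def[abs_def] by (intro indep_var_restrict[OF indep_Y]) auto
  from expectation_indep_var_iterated[OF this, of "\<lambda>(x, y). h (x, y n)"] assms(2)
  have "(\<integral>\<omega>. h (past n \<omega>, Y n \<omega>) \<partial>M) =
      (\<integral>\<omega>. (\<integral>y. h (past n \<omega>, y n) \<partial>distr M (PiM {n} (\<lambda>_. Q)) ?next) \<partial>M)"
    by (simp add: integrable_const_bound[of _ C])
  also have "\<dots> = (\<integral>\<omega>. (\<integral>y. h (past n \<omega>, y) \<partial>distr M Q (Y n)) \<partial>M)"
  proof (rule Bochner_Integration.integral_cong[OF refl])
    fix \<omega> assume [measurable (raw)]: "\<omega> \<in> space M"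
    have [measurable (raw)]: "past n \<omega> \<in> space (PiM {..<n} (\<lambda>_. Q))"
      using \<open>\<omega> \<in> space M\<close> by (rule measurable_space[OF measurable_past])
    show "(\<integral>y. h (past n \<omega>, y n) \<partial>distr M (PiM {n} (\<lambda>_. Q)) ?next) =
        (\<integral>y. h (past n \<omega>, y) \<partial>distr M Q (Y n))"
      by (simp add: integral_distr)
  qed
  finally show ?thesis by (simp add: distr_Y)
qed

lemma measurable_window_trajectory [measurable]:
  "(\<lambda>\<omega>. window k (trajectory \<omega>)) \<in> measurable M (Q \<Otimes>\<^sub>M Q \<Otimes>\<^sub>M Q)"
  unfolding window_def by measurable

lemma measurable_iexp_sum_window:
  fixes f :: "'b \<times> 'b \<times> 'b \<Rightarrow> real"
  assumes "f \<in> borel_measurable (Q \<Otimes>\<^sub>M Q \<Otimes>\<^sub>M Q)" and "\<And>j. j < k \<Longrightarrow> j + 2 < n"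
  shows "(\<lambda>x. iexp (s * (\<Sum>j<k. f (window j x)))) \<in> borel_measurable (PiM {..<n} (\<lambda>_. Q))"
proof -
  have "(\<lambda>x. f (window j x)) \<in> borel_measurable (PiM {..<n} (\<lambda>_. Q))" if "j < k" for j
  proof (rule measurable_compose[OF _ assms(1)])
    show "window j \<in> measurable (PiM {..<n} (\<lambda>_. Q)) (Q \<Otimes>\<^sub>M Q \<Otimes>\<^sub>M Q)"
      using assms(2)[OF that] unfolding window_def[abs_def]
      by (intro measurable_Pair measurable_component_singleton) auto
  qed
  then have "(\<lambda>x. \<Sum>j<k. f (window j x)) \<in> borel_measurable (PiM {..<n} (\<lambda>_. Q))"
    by (intro borel_measurable_sum) auto
  then show ?thesis
    by (rule measurable_compose[where g = "\<lambda>y. iexp (s * y)"]) measurable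
qed

lemma sum_window_past:
  assumes "\<And>j. j < k \<Longrightarrow> j + 2 < n"
  shows "(\<Sum>j<k. f (window j (past n \<omega>))) = (\<Sum>j<k. f (window j (trajectory \<omega>)))"
proof (intro sum.cong refl)
  fix j assume "j \<in> {..<k}"
  then have "j + 2 < n"
    using assms by blast
  then show "f (window j (past n \<omega>)) = f (window j (trajectory \<omega>))"
    by (simp add: window_def)
qed

lemma expectation_past_window_given2:
  fixes g :: "(nat \<Rightarrow> 'b) \<Rightarrow> complex"
  assumes [measurable]: "g \<in> borel_measurable (PiM {..<k + 2} (\<lambda>_. Q))" and "\<And>x. cmod (g x) \<le> 1"
    and "bounded_window_function Q f C"
  shows "(CLINT \<omega>|M. g (past (k + 2) \<omega>) * f (window k (trajectory \<omega>))) =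
    (CLINT \<omega>|M. g (past (k + 2) \<omega>) * window_mean_given2 Q f (Y k \<omega>) (Y (k + 1) \<omega>))"
proof -
  interpret bounded_window_function Q f C by fact
  let ?h = "\<lambda>(x, c). g x * complex_of_real (f (x k, x (k + 1), c))"
  have "cmod (?h x) \<le> C" for x
    using mult_mono[OF assms(2)[of "fst x"] abs_f_le] by (simp add: split_beta' norm_mult)
  moreover have "?h \<in> borel_measurable (PiM {..<k + 2} (\<lambda>_. Q) \<Otimes>\<^sub>M Q)"
    by measurable
  ultimately show ?thesis
    using expectation_integrate_out_next[of ?h "k + 2" C]
    by (simp add: window_def window_mean_given2_def)
qed

lemma expectation_past_window:
  fixes g :: "(nat \<Rightarrow> 'b) \<Rightarrow> complex"
  assumes [measurable]: "g \<in> borel_measurable (PiM {..<k} (\<lambda>_. Q))" and "\<And>x. cmod (g x) \<le> 1"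
    and "bounded_window_function Q f C"
  shows "(CLINT \<omega>|M. g (past k \<omega>) * f (window k (trajectory \<omega>))) =
    (CLINT \<omega>|M. g (past k \<omega>)) * window_mean Q f"
proof -
  interpret bounded_window_function Q f C by fact
  have restrict_past: "restrict (past n \<omega>) {..<k} = past k \<omega>" if "k \<le> n" for n \<omega>
    using that by (auto simp: past_def)
  have [measurable]: "(\<lambda>x. g (restrict x {..<k})) \<in> borel_measurable (PiM {..<n} (\<lambda>_. Q))"
    if "k \<le> n" for n
    using that by (intro measurable_compose[OF measurable_restrict_subset assms(1)]) auto
  have norm_mult_le: "cmod (g x * complex_of_real y) \<le> C" if "\<bar>y\<bar> \<le> C" for x y
    using mult_mono[OF assms(2)[of x] that] by (simp add: norm_mult)
  have "(CLINT \<omega>|M. g (past k \<omega>) * f (window k (trajectory \<omega>))) =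
      (CLINT \<omega>|M. g (past k \<omega>) * window_mean_given2 Q f (Y k \<omega>) (Y (k + 1) \<omega>))"
    using expectation_past_window_given2[of "\<lambda>x. g (restrict x {..<k})" k] assms(2,3)
    by (simp add: restrict_past)
  also have "\<dots> = (CLINT \<omega>|M. g (past k \<omega>) * window_mean_given1 Q f (Y k \<omega>))"
    using expectation_integrate_out_next[of
        "\<lambda>(x, b). g (restrict x {..<k}) * window_mean_given2 Q f (x k) b" "k + 1" C]
    by (simp add: split_beta' norm_mult_le abs_window_mean_given2_le restrict_past
        window_mean_given1_def)
  also have "\<dots> = (CLINT \<omega>|M. g (past k \<omega>)) * window_mean Q f"
    using expectation_integrate_out_next[of "\<lambda>(x, a). g x * window_mean_given1 Q f a" k C]
    by (simp add: split_beta' norm_mult_le abs_window_mean_given1_le window_mean_def)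
  finally show ?thesis .
qed

lemma expectation_iexp_sum_martingale_part:
  assumes "bounded_window_function Q f C"
  shows "(CLINT \<omega>|M. iexp (s * (\<Sum>j<k. martingale_part Q f (window j (trajectory \<omega>))))
     * martingale_part Q f (window k (trajectory \<omega>))) = 0"
proof -
  interpret bounded_window_function Q f C by fact
  define g where "g x = iexp (s * (\<Sum>j<k. martingale_part Q f (window j x)))" for x
  have g_past: "g (past (k + 2) \<omega>) = g (trajectory \<omega>)" for \<omega>
    unfolding g_def by (subst sum_window_past) auto
  have "g \<in> borel_measurable (PiM {..<k + 2} (\<lambda>_. Q))" "cmod (g x) \<le> 1" for x
    unfolding g_def[abs_def]
    by (auto intro!: measurable_iexp_sum_window simp del: of_real_sum of_real_mult)
  from expectation_past_window_given2[OF this bounded_window_function_martingale_part]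
  have "(CLINT \<omega>|M. g (trajectory \<omega>) * martingale_part Q f (window k (trajectory \<omega>))) =
      (CLINT \<omega>|M. g (trajectory \<omega>) *
        window_mean_given2 Q (martingale_part Q f) (Y k \<omega>) (Y (k + 1) \<omega>))"
    unfolding g_past .
  also have "\<dots> = (CLINT \<omega>|M. 0)"
    using measurable_space[OF measurable_Y]
    by (intro Bochner_Integration.integral_cong) (auto simp: window_mean_given2_martingale_part)
  finally show ?thesis by (simp add: g_def)
qed

lemma expectation_iexp_sum_martingale_part_square:
  assumes "bounded_window_function Q f C"
  shows "(CLINT \<omega>|M. iexp (s * (\<Sum>j<k - 2. martingale_part Q f (window j (trajectory \<omega>))))
     * ((martingale_part Q f (window k (trajectory \<omega>)))\<^sup>2 - window_variance Q f)) = 0"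
proof -
  interpret bounded_window_function Q f C by fact
  interpret D: bounded_window_function Q "martingale_part Q f" "6 * C"
    by (rule bounded_window_function_martingale_part)
  interpret D_square: bounded_window_function Q "\<lambda>x. (martingale_part Q f x)\<^sup>2" "(6 * C)\<^sup>2"
    by (rule D.bounded_window_function_square)
  define g where "g x = iexp (s * (\<Sum>j<k - 2. martingale_part Q f (window j x)))" for x
  have g_past: "g (past k \<omega>) = g (trajectory \<omega>)" for \<omega>
    unfolding g_def by (subst sum_window_past) auto
  have "g \<in> borel_measurable (PiM {..<k} (\<lambda>_. Q))" "cmod (g x) \<le> 1" for x
    unfolding g_def[abs_def]
    by (auto intro!: measurable_iexp_sum_window simp del: of_real_sum of_real_mult)
  from expectation_past_window[OF this
      D_square.bounded_window_function_diff_const[of "window_variance Q f"]]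
  show ?thesis
    unfolding g_past D_square.window_mean_diff_const by (simp add: g_def window_variance_def)
qed

lemma bounded_martingale_differences_martingale_part:
  assumes "bounded_window_function Q f C"
  shows "bounded_martingale_differences M (\<lambda>k \<omega>. martingale_part Q f (window k (trajectory \<omega>)))
     (6 * C) (window_variance Q f) 2"
proof -
  interpret bounded_window_function Q f C by fact
  show ?thesis
  proof (intro bounded_martingale_differences.intro bounded_martingale_differences_axioms.intro)
    show "(\<lambda>\<omega>. martingale_part Q f (window k (trajectory \<omega>))) \<in> borel_measurable M" for k
      by (rule measurable_compose[OF measurable_window_trajectory measurable_martingale_part])
  qed (intro prob_space_axioms abs_martingale_part_le
      expectation_iexp_sum_martingale_part[OF assms]
      expectation_iexp_sum_martingale_part_square[OF assms])+
qed

theorem central_limit_theorem_window_sum: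
  assumes "bounded_window_function Q f C" and "0 < window_variance Q f"
    and [measurable]: "\<And>n. U n \<in> borel_measurable M"
    and U_close: "\<And>n \<omega>. \<omega> \<in> space M \<Longrightarrow> \<bar>U n \<omega> - (\<Sum>k<n. f (window k (trajectory \<omega>)))\<bar> \<le> c"
  shows "weak_conv_m
     (\<lambda>n. distr M borel (\<lambda>\<omega>. (U n \<omega> - window_mean Q f * real n) / sqrt (real n)))
     (density lborel (normal_density 0 (sqrt (window_variance Q f))))"
proof -
  interpret bounded_window_function Q f C by fact
  interpret bounded_martingale_differences M "\<lambda>k \<omega>. martingale_part Q f (window k (trajectory \<omega>))"
      "6 * C" "window_variance Q f" 2
    by (rule bounded_martingale_differences_martingale_part) fact
  show ?thesis
  proof (rule weak_conv_m_distr_uniformly_close[OF _ _ _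
        central_limit_theorem_martingale_differences])
    show "(\<lambda>n. (c + 4 * C) / sqrt (real n)) \<longlonglongrightarrow> 0"
      by (rule tendsto_const_divide_sqrt)
    fix n \<omega> assume "\<omega> \<in> space M"
    then have "\<bar>U n \<omega> - window_mean Q f * real n - partial_sum n \<omega>\<bar> \<le> c + 4 * C"
      using U_close[of \<omega> n] abs_sum_window_diff_le[where x = "trajectory \<omega>" and n = n]
      unfolding partial_sum_def by linarith
    then show "\<bar>(U n \<omega> - window_mean Q f * real n) / sqrt (real n)
        - partial_sum n \<omega> / sqrt (real n)\<bar>
        \<le> (c + 4 * C) / sqrt (real n)"
      by (simp add: divide_right_mono flip: diff_divide_distrib)
  qed (simp_all add: real_distribution_normal assms(2))
qed

end

section \<open>The levels of a polyomino chain\<close>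

definition level :: "int \<times> int \<Rightarrow> int" where
  "level v = fst v + snd v"

definition side_corner :: "(nat \<Rightarrow> bool) \<Rightarrow> bool \<Rightarrow> nat \<Rightarrow> int \<times> int" where
  "side_corner L r k = sq_pos L k + (if r then (1, 0) else (0, 1))"

lemma dir_right_link: "k \<ge> 3 \<Longrightarrow> dir_right L k \<longleftrightarrow> (L k \<longleftrightarrow> dir_right L (k - 1))"
  by (cases k) auto

declare dir_right.simps(2) [simp del]

lemma sq_pos_Suc: "k \<ge> 1 \<Longrightarrow> sq_pos L (Suc k) = side_corner L (dir_right L (Suc k)) k"
  by (cases k) (auto simp: side_corner_def prod_eq_iff Let_def split: prod.splits)

declare sq_pos.simps(3) [simp del]

lemma level_sq_pos: "k \<ge> 1 \<Longrightarrow> level (sq_pos L k) = int k - 1"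
proof (induction k rule: dec_induct)
  case (step k)
  then show ?case by (simp add: sq_pos_Suc side_corner_def level_def)
qed (simp add: level_def)

lemma level_side_corner [simp]: "k \<ge> 1 \<Longrightarrow> level (side_corner L r k) = int k"
  using level_sq_pos[of k L] by (simp add: side_corner_def level_def)

lemma side_corner_eq_iff:
  assumes "j \<ge> 1" "k \<ge> 1"
  shows "side_corner L r j = side_corner L s k \<longleftrightarrow> r = s \<and> j = k"
proof
  assume eq: "side_corner L r j = side_corner L s k"
  then have "j = k"
    using level_side_corner[OF assms(1), of L r] level_side_corner[OF assms(2), of L s] by simp
  with eq show "r = s \<and> j = k"
    by (simp add: side_corner_def split: if_splits)
qed auto

definition upper_corner :: "(nat \<Rightarrow> bool) \<Rightarrow> nat \<Rightarrow> int \<times> int" where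
  "upper_corner L k = sq_pos L k + (1, 1)"

lemma upper_corner_eq: "k \<ge> 1 \<Longrightarrow> upper_corner L k = side_corner L (\<not> dir_right L (Suc k)) (Suc k)"
  by (simp add: upper_corner_def sq_pos_Suc side_corner_def add.assoc)

lemma level_upper_corner [simp]: "k \<ge> 1 \<Longrightarrow> level (upper_corner L k) = int k + 1"
  by (simp add: upper_corner_eq)

lemma sq_corners_eq:
  "sq_corners (sq_pos L k) = {sq_pos L k, upper_corner L k} \<union> range (\<lambda>r. side_corner L r k)"
  by (cases "sq_pos L k") (auto simp: sq_corners_def side_corner_def upper_corner_def UNIV_bool)

lemma sq_sides_eq:
  "sq_sides (sq_pos L k) =
    (\<Union>r. {{sq_pos L k, side_corner L r k}, {side_corner L r k, upper_corner L k}})"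
  by (cases "sq_pos L k") (auto simp: sq_sides_def side_corner_def upper_corner_def UNIV_bool)

lemma side_corner_in_pc_vertices: "1 \<le> k \<Longrightarrow> k \<le> n \<Longrightarrow> side_corner L r k \<in> pc_vertices n L"
  unfolding pc_vertices_def sq_corners_eq by (auto intro!: bexI[of _ k])

lemma pc_vertices_cases:
  assumes "v \<in> pc_vertices n L"
  obtains (origin) "v = (0, 0)"
    | (side_corner) r k where "v = side_corner L r k" "1 \<le> k" "k \<le> n + 1"
proof -
  obtain k where corner: "1 \<le> k" "k \<le> n" "v \<in> sq_corners (sq_pos L k)"
    using assms by (auto simp: pc_vertices_def)
  then consider (lower) "v = sq_pos L k" | (side) r where "v = side_corner L r k"
    | (upper) "v = upper_corner L k"
    unfolding sq_corners_eq by blast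
  then show ?thesis
  proof cases
    case lower
    show ?thesis
    proof (cases "k = 1")
      case False
      then have "v = side_corner L (dir_right L k) (k - 1)"
        using lower corner sq_pos_Suc[of "k - 1" L] by simp
      then show ?thesis using False corner by (intro that(2)[of "dir_right L k" "k - 1"]) auto
    qed (use lower that in simp)
  qed (use corner that upper_corner_eq in auto)
qed

lemma pc_adj_iff:
  "pc_adj n L u v \<longleftrightarrow> (\<exists>k\<in>{1..n}. \<exists>r.
     {u, v} = {sq_pos L k, side_corner L r k} \<or> {u, v} = {side_corner L r k, upper_corner L k})"
  unfolding pc_adj_def sq_sides_eq by simp

lemma pc_adj_cases:
  assumes "pc_adj n L u v"
  obtains (from_lower) k r where
      "k \<in> {1..n}" "u = sq_pos L k" "v = side_corner L r k" "level v = level u + 1"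
    | (to_upper) k r where
      "k \<in> {1..n}" "u = side_corner L r k" "v = upper_corner L k" "level v = level u + 1"
    | (down) "level v = level u - 1"
proof -
  obtain k r where square: "k \<in> {1..n}"
    and edge: "{u, v} = {sq_pos L k, side_corner L r k} \<or>
      {u, v} = {side_corner L r k, upper_corner L k}"
    using assms unfolding pc_adj_iff by blast
  have "level (sq_pos L k) = int k - 1" "level (side_corner L r k) = int k"
    "level (upper_corner L k) = int k + 1"
    using square by (simp_all add: level_sq_pos)
  then show ?thesis
    using edge square that unfolding doubleton_eq_iff by (elim disjE conjE) simp_all
qed

lemma pc_adj_level: "pc_adj n L u v \<Longrightarrow> level v = level u + 1 \<or> level v = level u - 1"
  by (erule pc_adj_cases) simp_all

lemma pc_adj_sym: "pc_adj n L u v \<longleftrightarrow> pc_adj n L v u"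
  by (simp add: pc_adj_def insert_commute)

lemma pc_adj_imp_vertex: "pc_adj n L u v \<Longrightarrow> v \<in> pc_vertices n L"
proof -
  have "e \<subseteq> sq_corners (sq_pos L k)" if "e \<in> sq_sides (sq_pos L k)" for e k
    using that unfolding sq_sides_eq sq_corners_eq by auto
  then show "pc_adj n L u v \<Longrightarrow> v \<in> pc_vertices n L"
    unfolding pc_adj_def pc_vertices_def by blast
qed

lemma pc_adj_side_corner_Suc_iff:
  assumes "1 \<le> k" "k < n"
  shows "pc_adj n L (side_corner L r k) (side_corner L s (Suc k)) \<longleftrightarrow> r = s \<or> r = dir_right L (Suc k)"
    (is "pc_adj n L ?u ?v \<longleftrightarrow> _")
proof
  assume "pc_adj n L ?u ?v"
  moreover have "level ?v = level ?u + 1"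
    using assms by simp
  ultimately consider (from_lower) j t where "1 \<le> j" "?u = sq_pos L j" "?v = side_corner L t j"
    | (to_upper) j t where "1 \<le> j" "?u = side_corner L t j" "?v = upper_corner L j"
    by (elim pc_adj_cases) auto
  then show "r = s \<or> r = dir_right L (Suc k)"
  proof cases
    case from_lower
    then have "j = Suc k" using assms by (simp add: side_corner_eq_iff)
    then show ?thesis using from_lower assms by (simp add: sq_pos_Suc side_corner_eq_iff)
  next
    case to_upper
    then show ?thesis using assms by (auto simp: upper_corner_eq side_corner_eq_iff)
  qed
next
  assume "r = s \<or> r = dir_right L (Suc k)"
  then consider (from_lower) "r = dir_right L (Suc k)"
    | (to_upper) "s \<noteq> dir_right L (Suc k)" "r \<noteq> dir_right L (Suc k)" by blast
  then show "pc_adj n L ?u ?v"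
  proof cases
    case from_lower
    then have "{?u, ?v} = {sq_pos L (Suc k), side_corner L s (Suc k)}"
      using assms by (simp add: sq_pos_Suc)
    then show ?thesis using assms unfolding pc_adj_iff by auto
  next
    case to_upper
    then have "{?u, ?v} = {side_corner L r k, upper_corner L k}"
      using assms by (simp add: upper_corner_eq)
    then show ?thesis using assms unfolding pc_adj_iff by fastforce
  qed
qed

lemma pc_adj_side_corner_iff:
  assumes "1 \<le> k" "k + 2 \<le> n"
  shows "pc_adj n L (side_corner L r (k + 1)) v \<longleftrightarrow>
      (\<exists>s. v = side_corner L s (k + 2) \<and> (r = s \<or> r = dir_right L (k + 2))) \<or>
      (\<exists>s. v = side_corner L s k \<and> (s = r \<or> s = dir_right L (k + 1)))"
proof -
  have adj_up: "pc_adj n L (side_corner L r (k + 1)) (side_corner L s (k + 2)) \<longleftrightarrow>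
      r = s \<or> r = dir_right L (k + 2)" for s
    using pc_adj_side_corner_Suc_iff[of "k + 1" n L r s] assms by simp
  have adj_down: "pc_adj n L (side_corner L r (k + 1)) (side_corner L s k) \<longleftrightarrow>
      s = r \<or> s = dir_right L (k + 1)" for s
    using pc_adj_side_corner_Suc_iff[of k n L s r] assms by (simp add: pc_adj_sym)
  have "(\<exists>s. v = side_corner L s (k + 2)) \<or> (\<exists>s. v = side_corner L s k)"
    if adj: "pc_adj n L (side_corner L r (k + 1)) v"
    using pc_adj_imp_vertex[OF adj]
  proof (cases rule: pc_vertices_cases)
    case origin
    then show ?thesis using pc_adj_level[OF adj] assms by (auto simp: level_def[of "(0, 0)"])
  next
    case (side_corner s j)
    then have "j = k + 2 \<or> j = k" using pc_adj_level[OF adj] assms by auto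
    with side_corner show ?thesis by blast
  qed
  then show ?thesis using adj_up adj_down by blast
qed

lemma at_dist_2_iff:
  "at_dist (pc_adj n L) 2 v w \<longleftrightarrow> v \<noteq> w \<and> (\<exists>u. pc_adj n L v u \<and> pc_adj n L u w)"
proof -
  have "\<not> pc_adj n L v w" if "pc_adj n L v u" "pc_adj n L u w" for u
    using that[THEN pc_adj_level] pc_adj_level[of n L v w] by auto
  then show ?thesis
    unfolding at_dist_def numeral_2_eq_2
    by (simp add: less_Suc_eq all_conj_distrib del: split_paired_Ex split_paired_All) blast
qed

lemma tau_eq_card: "tau n L v = card {w. v \<noteq> w \<and> (\<exists>u. pc_adj n L v u \<and> pc_adj n L u w)}"
  unfolding tau_def at_dist_2_iff by (rule arg_cong[where f = card]) (auto intro: pc_adj_imp_vertex)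

lemma pc_adj_two_step_side_corner_iff:
  assumes "1 \<le> k" "k + 4 \<le> n"
  shows "(\<exists>u. pc_adj n L (side_corner L r (k + 2)) u \<and> pc_adj n L u w) \<longleftrightarrow>
    (\<exists>s. w = side_corner L s (k + 4) \<and> (s = r \<or> r = dir_right L (k + 3) \<or> r = dir_right L (k + 4))) \<or>
    (\<exists>s. w = side_corner L s (k + 2)) \<or>
    (\<exists>s. w = side_corner L s k \<and> (s = r \<or> s = dir_right L (k + 1) \<or> s = dir_right L (k + 2)))"
    (is "_ \<longleftrightarrow> ?two_steps")
proof -
  have adj: "pc_adj n L (side_corner L r (k + 1)) v \<longleftrightarrow>
      (\<exists>s. v = side_corner L s (k + 2) \<and> (r = s \<or> r = dir_right L (k + 2))) \<or>
      (\<exists>s. v = side_corner L s k \<and> (s = r \<or> s = dir_right L (k + 1)))"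
    "pc_adj n L (side_corner L r (k + 2)) v \<longleftrightarrow>
      (\<exists>s. v = side_corner L s (k + 3) \<and> (r = s \<or> r = dir_right L (k + 3))) \<or>
      (\<exists>s. v = side_corner L s (k + 1) \<and> (s = r \<or> s = dir_right L (k + 2)))"
    "pc_adj n L (side_corner L r (k + 3)) v \<longleftrightarrow>
      (\<exists>s. v = side_corner L s (k + 4) \<and> (r = s \<or> r = dir_right L (k + 4))) \<or>
      (\<exists>s. v = side_corner L s (k + 2) \<and> (s = r \<or> s = dir_right L (k + 3)))" for r v
    using pc_adj_side_corner_iff[of k n L r v] pc_adj_side_corner_iff[of "k + 1" n L r v]
      pc_adj_side_corner_iff[of "k + 2" n L r v] assms
    by (simp_all add: numeral_3_eq_3 numeral_2_eq_2 eval_nat_numeral)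
  have "(\<exists>u. pc_adj n L (side_corner L r (k + 2)) u \<and> pc_adj n L u w) \<longleftrightarrow>
     (\<exists>s. (r = s \<or> r = dir_right L (k + 3)) \<and> pc_adj n L (side_corner L s (k + 3)) w) \<or>
     (\<exists>s. (s = r \<or> s = dir_right L (k + 2)) \<and> pc_adj n L (side_corner L s (k + 1)) w)"
    unfolding adj(2) by blast
  also have "\<dots> \<longleftrightarrow> ?two_steps"
    unfolding adj ex_bool_eq by (cases r) (simp_all, argo+)
  finally show ?thesis .
qed

lemma tau_side_corner:
  assumes "1 \<le> k" "k + 4 \<le> n"
  shows "tau n L (side_corner L r (k + 2)) = 3
    + of_bool (r = dir_right L (k + 3) \<or> r = dir_right L (k + 4))
    + of_bool (r \<noteq> dir_right L (k + 1) \<or> r \<noteq> dir_right L (k + 2))"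
proof -
  let ?up = "r = dir_right L (k + 3) \<or> r = dir_right L (k + 4)"
  let ?down = "r \<noteq> dir_right L (k + 1) \<or> r \<noteq> dir_right L (k + 2)"
  define second where "second up down =
      {side_corner L (\<not> r) (k + 2), side_corner L r (k + 4), side_corner L r k}
      \<union> (if up then {side_corner L (\<not> r) (k + 4)} else {})
      \<union> (if down then {side_corner L (\<not> r) k} else {})" for up down
  have "{w. side_corner L r (k + 2) \<noteq> w \<and>
      (\<exists>u. pc_adj n L (side_corner L r (k + 2)) u \<and> pc_adj n L u w)} = second ?up ?down"
    unfolding pc_adj_two_step_side_corner_iff[OF assms] ex_bool_eq second_def
    using assms(1) by (cases r) (auto simp: side_corner_eq_iff)
  moreover have "card (second up down) = 3 + of_bool up + of_bool down" for up down
    using assms(1) by (simp add: second_def side_corner_eq_iff)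
  ultimately show ?thesis by (simp only: tau_eq_card)
qed

definition pc_level :: "nat \<Rightarrow> (nat \<Rightarrow> bool) \<Rightarrow> int \<Rightarrow> (int \<times> int) set" where
  "pc_level n L l = {v \<in> pc_vertices n L. level v = l}"

lemma pc_level_subset:
  "pc_level n L l \<subseteq> (if l = 0 then {(0, 0)} else range (\<lambda>r. side_corner L r (nat l)))"
proof
  fix v assume "v \<in> pc_level n L l"
  then have "v \<in> pc_vertices n L" "level v = l"
    by (simp_all add: pc_level_def)
  then show "v \<in> (if l = 0 then {(0, 0)} else range (\<lambda>r. side_corner L r (nat l)))"
    by (cases rule: pc_vertices_cases) (auto simp: level_def[of "(0, 0)"])
qed

lemma pc_level_eq:
  assumes "1 \<le> k" "k \<le> n"
  shows "pc_level n L (int k) = range (\<lambda>r. side_corner L r k)"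
  using assms pc_level_subset[of n L "int k"]
  by (auto simp: pc_level_def side_corner_in_pc_vertices)

lemma finite_pc_level: "finite (pc_level n L l)"
  by (rule finite_subset[OF pc_level_subset]) auto

lemma card_pc_level_le: "card (pc_level n L l) \<le> 2"
proof -
  have "card (pc_level n L l) \<le>
      card (if l = 0 then {(0, 0)} else range (\<lambda>r. side_corner L r (nat l)))"
    by (intro card_mono pc_level_subset) auto
  also have "\<dots> \<le> 2"
    using card_image_le[of UNIV "\<lambda>r. side_corner L r (nat l)"] by simp
  finally show ?thesis .
qed

lemma pc_vertices_eq_UN_pc_level: "pc_vertices n L = (\<Union>l\<le>n + 1. pc_level n L (int l))"
proof (intro equalityI subsetI)
  fix v assume vertex: "v \<in> pc_vertices n L"
  then show "v \<in> (\<Union>l\<le>n + 1. pc_level n L (int l))"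
  proof (cases rule: pc_vertices_cases)
    case origin
    then have "v \<in> pc_level n L (int 0)" using vertex by (simp add: pc_level_def level_def)
    then show ?thesis by blast
  next
    case (side_corner r k)
    then have "v \<in> pc_level n L (int k)" using vertex by (simp add: pc_level_def)
    then show ?thesis using side_corner by auto
  qed
qed (auto simp: pc_level_def)

lemma tau_le: "tau n L v \<le> 6"
proof -
  have "{w \<in> pc_vertices n L. at_dist (pc_adj n L) 2 v w} \<subseteq>
      (\<Union>i\<in>{-2, 0, 2}. pc_level n L (level v + i))"
    by (force simp: at_dist_2_iff pc_level_def dest!: pc_adj_level)
  then have "tau n L v \<le> card (\<Union>i\<in>{-2, 0, 2}. pc_level n L (level v + i))"
    unfolding tau_def by (intro card_mono) (auto simp: finite_pc_level)
  also have "\<dots> \<le> (\<Sum>i\<in>{-2, 0, 2}. card (pc_level n L (level v + i)))"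
    by (rule card_UN_le) simp
  also have "\<dots> \<le> (\<Sum>i\<in>{-2, 0, 2 :: int}. 2)"
    by (intro sum_mono card_pc_level_le)
  finally show ?thesis by simp
qed

definition level_sum :: "nat \<Rightarrow> (nat \<Rightarrow> bool) \<Rightarrow> nat \<Rightarrow> nat" where
  "level_sum n L l = (\<Sum>v\<in>pc_level n L (int l). (tau n L v)\<^sup>2)"

lemma level_sum_le: "level_sum n L l \<le> 72"
proof -
  have "level_sum n L l \<le> (\<Sum>v\<in>pc_level n L (int l). 6\<^sup>2)"
    unfolding level_sum_def by (intro sum_mono power_mono tau_le) auto
  also have "\<dots> \<le> 72"
    using card_pc_level_le[of n L "int l"] by simp
  finally show ?thesis .
qed

lemma ZC1_eq_sum_level_sum: "ZC1 n L = (\<Sum>l\<le>n + 1. level_sum n L l)"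
  unfolding ZC1_def level_sum_def pc_vertices_eq_UN_pc_level
  by (rule sum.UNION_disjoint) (auto simp: finite_pc_level, auto simp: pc_level_def)

definition link_weight :: "bool \<times> bool \<times> bool \<Rightarrow> real" where
  "link_weight = (\<lambda>(a, b, c). 50 - 9 * of_bool a - 9 * of_bool c + 2 * of_bool (a \<and> \<not> b \<and> c))"

lemma link_weight_bounds: "0 \<le> link_weight x" "link_weight x \<le> 50"
  by (auto simp: link_weight_def split: prod.splits)

lemma level_sum_eq_link_weight:
  assumes "3 \<le> l" "l + 2 \<le> n"
  shows "real (level_sum n L l) = link_weight (window l L)"
proof -
  define k where "k = l - 2"
  have shift: "1 \<le> k" "k + 4 \<le> n" "l = k + 2"
    using assms by (auto simp: k_def)
  have "level_sum n L l = (tau n L (side_corner L True l))\<^sup>2 + (tau n L (side_corner L False l))\<^sup>2"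
    using assms by (simp add: level_sum_def pc_level_eq UNIV_bool side_corner_eq_iff)
  moreover have "dir_right L (k + 2) \<longleftrightarrow> (L l \<longleftrightarrow> dir_right L (k + 1))"
    "dir_right L (k + 3) \<longleftrightarrow> (L (l + 1) \<longleftrightarrow> dir_right L (k + 2))"
    "dir_right L (k + 4) \<longleftrightarrow> (L (l + 2) \<longleftrightarrow> dir_right L (k + 3))"
    using shift dir_right_link[of "k + 2" L] dir_right_link[of "k + 3" L] dir_right_link[of "k + 4" L]
    by (simp_all add: numeral_eq_Suc)
  ultimately show ?thesis
    unfolding tau_side_corner[OF shift(1,2)] shift(3) link_weight_def window_def
    by (cases "L l"; cases "L (l + 1)"; cases "L (l + 2)"; cases "dir_right L (k + 1)")
      (simp_all add: shift)
qed

lemma sum_diff_subset_bounds: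
  fixes f :: "'i \<Rightarrow> real"
  assumes "finite A" "B \<subseteq> A" "\<And>i. i \<in> A \<Longrightarrow> 0 \<le> f i" "\<And>i. i \<in> A \<Longrightarrow> f i \<le> b"
  shows "sum f A - sum f B \<in> {0..real (card A - card B) * b}"
proof -
  have "sum f A - sum f B = sum f (A - B)"
    using assms(1,2) by (simp add: sum_diff)
  moreover have "0 \<le> sum f (A - B)"
    using assms(3) by (intro sum_nonneg) auto
  moreover have "sum f (A - B) \<le> real (card (A - B)) * b"
    using assms(4) by (intro sum_bounded_above) auto
  moreover have "card (A - B) = card A - card B"
    using assms(1,2) by (simp add: card_Diff_subset finite_subset)
  ultimately show ?thesis by simp
qed

lemma abs_ZC1_minus_sum_link_weight_le:
  "\<bar>real (ZC1 n L) - (\<Sum>k<n. link_weight (window k (\<lambda>i. L (i + 3))))\<bar> \<le> 432"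
proof -
  let ?interior = "{3..<n - 1}"
  have "(\<Sum>l\<in>?interior. real (level_sum n L l)) = (\<Sum>l\<in>?interior. link_weight (window l L))"
    by (intro sum.cong) (auto simp: level_sum_eq_link_weight)
  moreover have "(\<Sum>k<n. link_weight (window k (\<lambda>i. L (i + 3)))) =
      (\<Sum>l\<in>{3..<n + 3}. link_weight (window l L))"
    using sum.shift_bounds_nat_ivl[of "\<lambda>l. link_weight (window l L)" 0 3 n]
    by (simp add: lessThan_atLeast0 window_def add_ac)
  moreover have "real (ZC1 n L) - (\<Sum>l\<in>?interior. real (level_sum n L l))
      \<in> {0..real (card {..n + 1} - card ?interior) * 72}"
    unfolding ZC1_eq_sum_level_sum of_nat_sum using level_sum_le
    by (intro sum_diff_subset_bounds) auto
  moreover have "(\<Sum>l\<in>{3..<n + 3}. link_weight (window l L))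
      - (\<Sum>l\<in>?interior. link_weight (window l L))
      \<in> {0..real (card {3..<n + 3} - card ?interior) * 50}"
    using link_weight_bounds by (intro sum_diff_subset_bounds) auto
  moreover have "real (card {..n + 1} - card ?interior) \<le> 6"
    "real (card {3..<n + 3} - card ?interior) \<le> 4"
    by auto
  ultimately show ?thesis unfolding atLeastAtMost_iff by linarith
qed

lemma dir_right_cong:
  assumes "\<And>i. 3 \<le> i \<Longrightarrow> i \<le> n \<Longrightarrow> L i = L' i" "k \<le> n"
  shows "dir_right L k = dir_right L' k"
  using assms(2) by (induction k) (auto simp: dir_right.simps assms(1))

lemma sq_pos_cong:
  assumes "\<And>i. 3 \<le> i \<Longrightarrow> i \<le> n \<Longrightarrow> L i = L' i" "k \<le> n"
  shows "sq_pos L k = sq_pos L' k"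
  using assms(2)
proof (induction k)
  case (Suc k)
  show ?case
  proof (cases "k = 0")
    case False
    then show ?thesis
      using Suc dir_right_cong[OF assms(1) Suc.prems] by (simp add: sq_pos_Suc side_corner_def)
  qed simp
qed simp

lemma ZC1_cong:
  assumes "\<And>i. 3 \<le> i \<Longrightarrow> i \<le> n \<Longrightarrow> L i = L' i"
  shows "ZC1 n L = ZC1 n L'"
proof -
  have "sq_pos L k = sq_pos L' k" if "k \<in> {1..n}" for k
    using that by (intro sq_pos_cong assms) auto
  then have "pc_vertices n L = pc_vertices n L'" "pc_adj n L = pc_adj n L'"
    by (simp_all add: pc_vertices_def pc_adj_def fun_eq_iff)
  then show ?thesis
    by (simp add: ZC1_def tau_def)
qed

section \<open>Random polyomino chains\<close>

lemma measurable_finitely_determined: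
  fixes f :: "('i \<Rightarrow> 'b :: countable) \<Rightarrow> 'c :: topological_space"
  assumes "finite A" "\<And>i. i \<in> A \<Longrightarrow> X i \<in> measurable M (count_space UNIV)"
    and cong: "\<And>L L'. (\<And>i. i \<in> A \<Longrightarrow> L i = L' i) \<Longrightarrow> f L = f L'"
  shows "(\<lambda>\<omega>. f (\<lambda>i. X i \<omega>)) \<in> borel_measurable M"
proof -
  have "(\<lambda>\<omega>. \<lambda>i\<in>A. X i \<omega>) \<in> measurable M (PiM A (\<lambda>_. count_space UNIV))"
    using assms(2) by (rule measurable_restrict)
  moreover have "f \<in> borel_measurable (PiM A (\<lambda>_. count_space UNIV))"
    using assms(1) by (subst count_space_PiM_finite) auto
  ultimately have "(\<lambda>\<omega>. f (\<lambda>i\<in>A. X i \<omega>)) \<in> borel_measurable M"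
    by (rule measurable_compose)
  then show ?thesis
    using cong[of "\<lambda>i\<in>A. X i _" "\<lambda>i. X i _"] by simp
qed

lemma (in prob_space) distr_eq_bernoulli_pmf:
  assumes [measurable]: "X \<in> measurable M (count_space UNIV)" and "prob {\<omega> \<in> space M. X \<omega>} = p"
  shows "distr M (measure_pmf (bernoulli_pmf p)) X = measure_pmf (bernoulli_pmf p)"
proof (rule measure_eqI_countable[of _ UNIV])
  have "0 \<le> p" "p \<le> 1"
    using assms(2) by auto
  fix b
  have "prob {\<omega> \<in> space M. \<not> X \<omega>} = 1 - p"
    using prob_neg[of X] assms(2) by simp
  then have "prob (X -` {b} \<inter> space M) = pmf (bernoulli_pmf p) b"
    using assms(2) \<open>0 \<le> p\<close> \<open>p \<le> 1\<close> by (cases b) (simp_all add: vimage_def Int_def conj_commute)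
  then show "emeasure (distr M (measure_pmf (bernoulli_pmf p)) X) {b} =
      emeasure (measure_pmf (bernoulli_pmf p)) {b}"
    by (simp add: emeasure_distr emeasure_eq_measure emeasure_pmf_single)
qed auto

lemma (in prob_space) iid_sequence_bernoulli:
  assumes "indep_vars (\<lambda>_. count_space UNIV) X {m..}"
    and "\<And>k. k \<ge> m \<Longrightarrow> prob {\<omega> \<in> space M. X k \<omega>} = p"
  shows "iid_sequence M (measure_pmf (bernoulli_pmf p)) (\<lambda>k. X (k + m))"
proof unfold_locales
  have "X k \<in> measurable M (count_space UNIV)" if "k \<ge> m" for k
    using assms(1) that by (auto simp: indep_vars_def)
  then show "distr M (measure_pmf (bernoulli_pmf p)) (X (k + m)) = measure_pmf (bernoulli_pmf p)"
    for k
    using assms(2) by (intro distr_eq_bernoulli_pmf) auto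
  have "indep_vars (\<lambda>k. PiM {k + m} (\<lambda>_. count_space UNIV)) (\<lambda>k \<omega>. \<lambda>i\<in>{k + m}. X i \<omega>) UNIV"
    using assms(1) by (rule indep_vars_restrict) (auto simp: disjoint_family_on_def)
  then have "indep_vars (\<lambda>_. measure_pmf (bernoulli_pmf p))
      (\<lambda>k \<omega>. (\<lambda>i\<in>{k + m}. X i \<omega>) (k + m)) UNIV"
    by (rule indep_vars_compose2) (simp add: measurable_component_singleton)
  then show "indep_vars (\<lambda>_. measure_pmf (bernoulli_pmf p)) (\<lambda>k. X (k + m)) UNIV"
    by simp
qed

lemma bounded_window_function_link_weight:
  "bounded_window_function (measure_pmf (bernoulli_pmf p)) link_weight 50"
proof unfold_locales
  show "\<bar>link_weight x\<bar> \<le> 50" for x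
    using link_weight_bounds[of x] by simp
  show "link_weight \<in> borel_measurable (measure_pmf (bernoulli_pmf p) \<Otimes>\<^sub>M
      measure_pmf (bernoulli_pmf p) \<Otimes>\<^sub>M measure_pmf (bernoulli_pmf p))"
    unfolding link_weight_def by measurable
qed

lemma window_mean_link_weight:
  assumes "0 \<le> p" "p \<le> 1"
  shows "window_mean (bernoulli_pmf p) link_weight = 50 - 18 * p + 2 * p ^ 2 - 2 * p ^ 3"
  using assms
  by (simp add: window_mean_def window_mean_given1_def window_mean_given2_def link_weight_def
      algebra_simps power2_eq_square power3_eq_cube)

lemma window_variance_link_weight:
  assumes "0 \<le> p" "p \<le> 1"
  shows "window_variance (bernoulli_pmf p) link_weight =
    4 * p * (1 - p) * (5 * p ^ 4 - 7 * p ^ 3 + 56 * p ^ 2 - 35 * p + 81)"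
  using assms
  by (simp add: window_variance_def martingale_part_def window_mean_def window_mean_given1_def
      window_mean_given2_def link_weight_def, algebra)

lemma window_variance_link_weight_pos:
  assumes "0 < p" "p < 1"
  shows "0 < window_variance (bernoulli_pmf p) link_weight"
proof -
  have "p ^ 3 \<le> 1" "0 \<le> p ^ 4" "0 \<le> p ^ 2"
    using assms by (auto intro: power_le_one)
  then have "0 < 5 * p ^ 4 - 7 * p ^ 3 + 56 * p ^ 2 - 35 * p + 81"
    using assms(2) by linarith
  then show ?thesis
    using assms by (simp add: window_variance_link_weight)
qed

lemma measurable_ZC1:
  assumes "\<And>k. k \<ge> 3 \<Longrightarrow> X k \<in> measurable M (count_space UNIV)"
  shows "(\<lambda>\<omega>. real (ZC1 n (\<lambda>k. X k \<omega>))) \<in> borel_measurable M"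
  using assms by (intro measurable_finitely_determined[of "{3..n}"]) (auto intro: ZC1_cong)

theorem theorem3:
  fixes M :: "'a measure" and X :: "nat \<Rightarrow> 'a \<Rightarrow> bool" and p :: real
  assumes "prob_space M"
    and "0 < p" and "p < 1"
    and "prob_space.indep_vars M (\<lambda>_. count_space UNIV) X {3..}"
    and "\<And>k. k \<ge> 3 \<Longrightarrow> measure M {\<omega> \<in> space M. X k \<omega>} = p"
  shows "weak_conv_m
     (\<lambda>n. distr M borel
        (\<lambda>\<omega>. (real (ZC1 n (\<lambda>k. X k \<omega>)) - (50 - 18 * p + 2 * p ^ 2 - 2 * p ^ 3) * real n)
              / sqrt (real n)))
     (density lborel (normal_density 0
        (sqrt (4 * p * (1 - p) * (5 * p ^ 4 - 7 * p ^ 3 + 56 * p ^ 2 - 35 * p + 81)))))"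
proof -
  interpret prob_space M by fact
  interpret iid_sequence M "measure_pmf (bernoulli_pmf p)" "\<lambda>k. X (k + 3)"
    using assms(4,5) by (rule iid_sequence_bernoulli)
  have measurable_index: "(\<lambda>\<omega>. real (ZC1 n (\<lambda>k. X k \<omega>))) \<in> borel_measurable M" for n
    using assms(4) by (intro measurable_ZC1) (auto simp: indep_vars_def)
  have index_close:
    "\<bar>real (ZC1 n (\<lambda>k. X k \<omega>)) - (\<Sum>k<n. link_weight (window k (trajectory \<omega>)))\<bar> \<le> 432" for n \<omega>
    by (rule abs_ZC1_minus_sum_link_weight_le)
  show ?thesis
    using central_limit_theorem_window_sum[OF bounded_window_function_link_weight
        window_variance_link_weight_pos[OF assms(2,3)] measurable_index index_close] assms(2,3)
    by (simp add: window_mean_link_weight window_variance_link_weight)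
qed

end
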